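(* Let $\underline m=(m_i)_{i\ge1}$ be a sequence of positive integers, $M_j=m_1+\dots+m_j$ ($M_0=0$), let $n\ge1$, and let $\psi:\mathbb Z_p\to\mathbb C_p^\times$ be an additive character of conductor $p^{M_{n-1}+k}$ with $1\le k\le m_n$ (so $\psi$ may be viewed as a character of $\mathbb Z/p^{M_n}$). Consider the function $F:\prod_{i=1}^n\mathbb Z/p^{m_i}\to\mathbb C_p^\times$, $F(a)=\psi(d_{n,\underline m}(a))$. For $\chi=(\chi_1,\ldots,\chi_n)\in\prod_{i=1}^n\widehat{\mathbb Z/p^{m_i}}$, the Fourier coefficient $\langle F,\chi\rangle$ is zero unless $\chi_n(a)=\psi(p^{M_{n-1}}a)$ for all $a\in\mathbb Z/p^{m_n}$, in which case $$\langle F,\chi\rangle=p^{m_n}\prod_{i=1}^{n-1}\frac{\psi(p^{M_i})-1}{\psi(p^{M_{i-1}})\overline{\chi_i}(1)-1}.$$ In particular all nonzero Fourier coefficients of $F$ have the same $p$-adic valuation.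
   Context: Digit map: for $a\in\mathbb Z/p^{m}$ let $\tilde a\in\{0,\ldots,p^{m}-1\}$ be its representative. The bijection of sets $d_{n,\underline m}:\prod_{i=1}^n\mathbb Z/p^{m_i}\to\mathbb Z/p^{M_n}$ is $(a_i)_i\mapsto\sum_{i=1}^n\tilde a_ip^{M_{i-1}}\bmod p^{M_n}$. For a finite abelian group $G$, $\widehat G$ is the group of characters $G\to\mathbb C_p^\times$, and for $f:G\to\mathbb C_p$ and $\chi\in\widehat G$, $\langle f,\chi\rangle=\sum_{g\in G}f(g)\overline{\chi}(g)$, where $\overline\chi=\chi^{-1}$. *)

theory Defs
  imports "HOL-Computational_Algebra.Primes" "HOL-Library.FuncSet"
begin

definition Msum :: "(nat \<Rightarrow> nat) \<Rightarrow> nat \<Rightarrow> nat" where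
  "Msum m j = (\<Sum>i=1..j. m i)"

text \<open>Z/N is modelled by the representatives {0..<N}; a character of Z/N with values
  in a field is a function on these representatives that is a homomorphism from
  (Z/N,+) to the multiplicative group.\<close>
definition is_char_mod :: "nat \<Rightarrow> (nat \<Rightarrow> 'a::field) \<Rightarrow> bool" where
  "is_char_mod N \<chi> \<longleftrightarrow> \<chi> 0 = 1 \<and> (\<forall>a<N. \<forall>b<N. \<chi> ((a + b) mod N) = \<chi> a * \<chi> b)"

definition has_conductor :: "nat \<Rightarrow> nat \<Rightarrow> (nat \<Rightarrow> 'a::field) \<Rightarrow> nat \<Rightarrow> bool" where
  "has_conductor p N \<psi> c \<longleftrightarrow> c \<le> N \<and>
     (\<forall>x<p^N. \<psi> ((p^c * x) mod p^N) = 1) \<and>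
     (0 < c \<longrightarrow> (\<exists>x<p^N. \<psi> ((p^(c-1) * x) mod p^N) \<noteq> 1))"

definition digit_map :: "nat \<Rightarrow> (nat \<Rightarrow> nat) \<Rightarrow> nat \<Rightarrow> (nat \<Rightarrow> nat) \<Rightarrow> nat" where
  "digit_map p m n a = (\<Sum>i=1..n. a i * p ^ Msum m (i - 1)) mod p ^ Msum m n"

text \<open>Fourier coefficient <F, chi> = sum_g F(g) * conj(chi)(g), where the character of the
  product group is chi(a) = prod_i chi_i(a_i) and conj chi = chi^{-1}.\<close>
definition fourier_coeff ::
  "nat \<Rightarrow> (nat \<Rightarrow> nat) \<Rightarrow> nat \<Rightarrow> ((nat \<Rightarrow> nat) \<Rightarrow> 'a::field) \<Rightarrow> (nat \<Rightarrow> nat \<Rightarrow> 'a) \<Rightarrow> 'a" where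
  "fourier_coeff p m n F \<chi> =
     (\<Sum>a\<in>(\<Pi>\<^sub>E i\<in>{1..n}. {..<p ^ m i}). F a * inverse (\<Prod>i=1..n. \<chi> i (a i)))"

end

theory Submission
  imports Defs
begin

text \<open>Characters of \<open>\<int>/N\<close> are determined by their value at 1, so
  \<open>\<psi>(d(a)) = \<psi>(1)^(\<Sum>\<^sub>i a\<^sub>i p^M\<^sub>i\<^sub>-\<^sub>1)\<close>: the carries of the digit map are invisible to \<open>\<psi>\<close>.
  Hence \<open>F \<cdot> \<chi>\<inverse>\<close> factors as \<open>\<Prod>\<^sub>i z\<^sub>i^a\<^sub>i\<close> with \<open>z\<^sub>i = \<psi>(p^M\<^sub>i\<^sub>-\<^sub>1) / \<chi>\<^sub>i(1)\<close>, and the Fourier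
  coefficient is a product of geometric sums over \<open>j < p^m\<^sub>i\<close>. As \<open>z\<^sub>i^(p^m\<^sub>i) = \<psi>(p^M\<^sub>i)\<close>, the
  conductor gives \<open>z\<^sub>i \<noteq> 1\<close> for \<open>i < n\<close>, while \<open>z\<^sub>n\<close> is a \<open>p^m\<^sub>n\<close>-th root of unity whose
  geometric sum vanishes unless \<open>z\<^sub>n = 1\<close>, i.e. unless \<open>\<chi>\<^sub>n = \<psi>(p^M\<^sub>n\<^sub>-\<^sub>1 \<cdot>)\<close>.\<close>

lemma Msum_pred: "0 < i \<Longrightarrow> Msum m i = Msum m (i - 1) + m i"
  by (cases i) (simp_all add: Msum_def)

lemma Msum_mono: "i \<le> j \<Longrightarrow> Msum m i \<le> Msum m j"
  unfolding Msum_def by (intro sum_mono2) auto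

lemma is_char_mod_power:
  assumes "is_char_mod N \<chi>" "1 < N"
  shows "\<chi> (x mod N) = \<chi> 1 ^ x"
proof (induction x)
  case 0
  then show ?case using assms by (simp add: is_char_mod_def)
next
  case (Suc x)
  have "\<chi> (Suc x mod N) = \<chi> ((x mod N + 1) mod N)"
    by (simp add: mod_Suc_eq)
  also have "\<dots> = \<chi> (x mod N) * \<chi> 1"
    using assms unfolding is_char_mod_def by (meson mod_less_divisor order.strict_trans zero_less_one)
  finally show ?case using Suc by simp
qed

lemma is_char_mod_power_less:
  assumes "is_char_mod N \<chi>" "x < N"
  shows "\<chi> x = \<chi> 1 ^ x"
proof (cases "1 < N")
  case True
  then show ?thesis using is_char_mod_power[OF assms(1) True, of x] assms(2) by simp
next
  case False
  with assms(2) have "x = 0" by simp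
  with assms(1) show ?thesis by (simp add: is_char_mod_def)
qed

lemma is_char_mod_root_of_unity:
  assumes "is_char_mod N \<chi>" "1 < N"
  shows "\<chi> 1 ^ N = 1"
  using is_char_mod_power[OF assms, of N] assms(1) by (simp add: is_char_mod_def)

lemma has_conductor_ne_1:
  assumes "1 < p" and \<psi>: "is_char_mod (p ^ N) \<psi>" and cond: "has_conductor p N \<psi> c"
    and "e < c"
  shows "\<psi> (p ^ e) \<noteq> 1"
proof
  assume e: "\<psi> (p ^ e) = 1"
  obtain x where x: "\<psi> ((p ^ (c - 1) * x) mod p ^ N) \<noteq> 1"
    using cond \<open>e < c\<close> unfolding has_conductor_def by auto
  have "e < N" using cond \<open>e < c\<close> unfolding has_conductor_def by simp
  then have "1 < p ^ N" "p ^ e < p ^ N"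
    using \<open>1 < p\<close> one_less_power[OF \<open>1 < p\<close>, of N]
    by (simp_all add: power_strict_increasing_iff)
  have "p ^ (c - 1) = p ^ e * p ^ (c - 1 - e)"
    using \<open>e < c\<close> by (simp flip: power_add)
  then have "\<psi> ((p ^ (c - 1) * x) mod p ^ N) = (\<psi> 1 ^ p ^ e) ^ (p ^ (c - 1 - e) * x)"
    by (simp add: is_char_mod_power[OF \<psi> \<open>1 < p ^ N\<close>] power_mult mult.assoc)
  also have "\<psi> 1 ^ p ^ e = 1"
    using e is_char_mod_power_less[OF \<psi> \<open>p ^ e < p ^ N\<close>] by simp
  finally show False using x by simp
qed

lemma is_char_mod_eq_power_iff:
  assumes "is_char_mod N \<chi>" "1 < N"
  shows "(\<forall>a<N. \<chi> a = y ^ a) \<longleftrightarrow> \<chi> 1 = y"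
proof
  assume "\<forall>a<N. \<chi> a = y ^ a"
  then show "\<chi> 1 = y" using assms(2) by (metis power_one_right)
next
  assume "\<chi> 1 = y"
  then show "\<forall>a<N. \<chi> a = y ^ a" using is_char_mod_power_less[OF assms(1)] by blast
qed

lemma sum_power_divide_root_of_unity:
  fixes w c :: "'a::field_char_0"
  assumes "c ^ N = 1" "w ^ N = 1"
  shows "(\<Sum>j<N. (w / c) ^ j) = (if w = c then of_nat N else 0)"
proof (cases "N = 0")
  case False
  with assms(1) have "c \<noteq> 0" by (metis power_0_left zero_neq_one)
  moreover have "(w / c) ^ N = 1" using assms by (simp add: power_divide)
  ultimately show ?thesis using geometric_sum[of "w / c" N] by auto
qed simp

lemma sum_power_divide_not_root_of_unity:
  fixes w c :: "'a::field"
  assumes "c ^ N = 1" "w ^ N \<noteq> 1"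
  shows "(\<Sum>j<N. (w / c) ^ j) = (w ^ N - 1) / (w / c - 1)"
proof -
  have "(w / c) ^ N = w ^ N" using assms(1) by (simp add: power_divide)
  with assms(2) have "w / c \<noteq> 1" by auto
  with \<open>(w / c) ^ N = w ^ N\<close> show ?thesis by (simp add: geometric_sum)
qed

lemma fourier_coeff_digit_map:
  fixes w :: "'a::field" and c :: "nat \<Rightarrow> 'a"
  assumes \<psi>: "\<And>x. \<psi> (x mod p ^ Msum m n) = w ^ x"
    and \<chi>: "\<And>i x. i \<in> {1..n} \<Longrightarrow> x < p ^ m i \<Longrightarrow> \<chi> i x = c i ^ x"
  shows "fourier_coeff p m n (\<lambda>a. \<psi> (digit_map p m n a)) \<chi> =
    (\<Prod>i=1..n. \<Sum>j<p ^ m i. (w ^ p ^ Msum m (i - 1) / c i) ^ j)"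
proof -
  have "\<psi> (digit_map p m n a) * inverse (\<Prod>i=1..n. \<chi> i (a i)) =
      (\<Prod>i=1..n. (w ^ p ^ Msum m (i - 1) / c i) ^ a i)"
    if a: "a \<in> (\<Pi>\<^sub>E i\<in>{1..n}. {..<p ^ m i})" for a
  proof -
    have "\<psi> (digit_map p m n a) = (\<Prod>i=1..n. (w ^ p ^ Msum m (i - 1)) ^ a i)"
      unfolding digit_map_def \<psi>
      by (simp add: power_sum flip: power_mult) (simp add: mult.commute)
    moreover have "(\<Prod>i=1..n. \<chi> i (a i)) = (\<Prod>i=1..n. c i ^ a i)"
      using a by (intro prod.cong) (auto simp: PiE_iff intro: \<chi>)
    ultimately show ?thesis
      by (simp add: power_divide flip: prod_dividef divide_inverse)
  qed
  then show ?thesis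
    unfolding fourier_coeff_def by (simp add: prod_sum_PiE)
qed

lemma sum_digit_factor_below_conductor:
  fixes \<psi> \<chi> :: "nat \<Rightarrow> 'a::field"
  assumes \<psi>: "is_char_mod (p ^ N) \<psi>" and cond: "has_conductor p N \<psi> c"
    and \<chi>: "is_char_mod (p ^ m) \<chi>" and "1 < p" "0 < m" "M + m < c"
  shows "(\<Sum>j<p ^ m. (\<psi> 1 ^ p ^ M / \<chi> 1) ^ j) =
    (\<psi> (p ^ (M + m)) - 1) / (\<psi> (p ^ M) * inverse (\<chi> 1) - 1)"
proof -
  have "M + m < N" using cond \<open>M + m < c\<close> unfolding has_conductor_def by simp
  then have "p ^ M < p ^ N" "p ^ (M + m) < p ^ N"
    using \<open>1 < p\<close> by (simp_all add: power_strict_increasing_iff)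
  then have "\<psi> (p ^ (M + m)) = (\<psi> 1 ^ p ^ M) ^ p ^ m" "\<psi> (p ^ M) = \<psi> 1 ^ p ^ M"
    using is_char_mod_power_less[OF \<psi>] by (simp_all add: power_add power_mult)
  moreover have "\<chi> 1 ^ p ^ m = 1"
    using assms(4,5) by (intro is_char_mod_root_of_unity[OF \<chi>] one_less_power)
  moreover have "\<psi> (p ^ (M + m)) \<noteq> 1"
    using has_conductor_ne_1[OF \<open>1 < p\<close> \<psi> cond \<open>M + m < c\<close>] .
  ultimately show ?thesis
    by (simp add: sum_power_divide_not_root_of_unity flip: divide_inverse)
qed

lemma sum_digit_factor_top:
  fixes \<psi> \<chi> :: "nat \<Rightarrow> 'a::field_char_0"
  assumes \<psi>: "is_char_mod (p ^ (M + m)) \<psi>" and \<chi>: "is_char_mod (p ^ m) \<chi>"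
    and "1 < p" "0 < m"
  shows "(\<Sum>j<p ^ m. (\<psi> 1 ^ p ^ M / \<chi> 1) ^ j) =
    (if \<forall>a<p ^ m. \<chi> a = \<psi> ((p ^ M * a) mod p ^ (M + m)) then of_nat (p ^ m) else 0)"
proof -
  have pm: "1 < p ^ m" and pN: "1 < p ^ (M + m)"
    using assms(4) one_less_power[OF \<open>1 < p\<close>] by simp_all
  have "(\<psi> 1 ^ p ^ M) ^ p ^ m = 1"
    using is_char_mod_root_of_unity[OF \<psi> pN] by (simp add: power_add power_mult)
  moreover have "\<chi> 1 ^ p ^ m = 1"
    by (rule is_char_mod_root_of_unity[OF \<chi> pm])
  moreover have "(\<forall>a<p ^ m. \<chi> a = \<psi> ((p ^ M * a) mod p ^ (M + m))) \<longleftrightarrow> \<chi> 1 = \<psi> 1 ^ p ^ M"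
    using is_char_mod_eq_power_iff[OF \<chi> pm] by (simp add: is_char_mod_power[OF \<psi> pN] power_mult)
  ultimately show ?thesis
    by (simp add: sum_power_divide_root_of_unity eq_commute[of "\<chi> 1"])
qed

theorem lemma3p2:
  fixes p n k :: nat and m :: "nat \<Rightarrow> nat"
    and \<psi> :: "nat \<Rightarrow> 'a::field_char_0"
    and \<chi> :: "nat \<Rightarrow> nat \<Rightarrow> 'a"
  assumes "prime p"
    and "\<And>i. 1 \<le> i \<Longrightarrow> 0 < m i"
    and "1 \<le> n"
    and "1 \<le> k" and "k \<le> m n"
    and "is_char_mod (p ^ Msum m n) \<psi>"
    and "has_conductor p (Msum m n) \<psi> (Msum m (n - 1) + k)"
    and "\<And>i. i \<in> {1..n} \<Longrightarrow> is_char_mod (p ^ m i) (\<chi> i)"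
  shows "fourier_coeff p m n (\<lambda>a. \<psi> (digit_map p m n a)) \<chi> =
    (if (\<forall>a<p ^ m n. \<chi> n a = \<psi> ((p ^ Msum m (n - 1) * a) mod p ^ Msum m n))
     then of_nat (p ^ m n) *
        (\<Prod>i=1..n-1. (\<psi> (p ^ Msum m i) - 1) /
                       (\<psi> (p ^ Msum m (i - 1)) * inverse (\<chi> i 1) - 1))
     else 0)"
proof -
  define S where "S i = (\<Sum>j<p ^ m i. (\<psi> 1 ^ p ^ Msum m (i - 1) / \<chi> i 1) ^ j)" for i
  have "1 < p" using assms(1) by (rule prime_gt_1_nat)
  have "0 < m n" using assms(2,3) by simp
  have Mn: "Msum m n = Msum m (n - 1) + m n"
    using assms(3) by (simp add: Msum_pred)
  have "1 < p ^ Msum m n"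
    using Mn \<open>0 < m n\<close> by (intro one_less_power[OF \<open>1 < p\<close>]) simp
  then have "fourier_coeff p m n (\<lambda>a. \<psi> (digit_map p m n a)) \<chi> = (\<Prod>i=1..n. S i)"
    unfolding S_def
    by (intro fourier_coeff_digit_map is_char_mod_power[OF assms(6)] is_char_mod_power_less[OF assms(8)])
  also have "\<dots> = S n * (\<Prod>i=1..n-1. S i)"
    using assms(3) by (cases n) (simp_all add: prod.cl_ivl_Suc mult.commute)
  also have "(\<Prod>i=1..n-1. S i) =
      (\<Prod>i=1..n-1. (\<psi> (p ^ Msum m i) - 1) / (\<psi> (p ^ Msum m (i - 1)) * inverse (\<chi> i 1) - 1))"
  proof (intro prod.cong refl)
    fix i assume "i \<in> {1..n-1}"
    then have i: "i \<in> {1..n}" and Mi: "Msum m i = Msum m (i - 1) + m i"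
      and "Msum m (i - 1) + m i < Msum m (n - 1) + k"
      using assms(4) Msum_mono[of i "n - 1" m] Msum_pred[of i m] by auto
    then show "S i = (\<psi> (p ^ Msum m i) - 1) / (\<psi> (p ^ Msum m (i - 1)) * inverse (\<chi> i 1) - 1)"
      unfolding S_def Mi using assms(2)[of i]
      by (intro sum_digit_factor_below_conductor[OF assms(6,7) assms(8)[OF i] \<open>1 < p\<close>]) auto
  qed
  also have "S n = (if \<forall>a<p ^ m n. \<chi> n a = \<psi> ((p ^ Msum m (n - 1) * a) mod p ^ Msum m n)
      then of_nat (p ^ m n) else 0)"
    unfolding S_def Mn using assms(3)
    by (intro sum_digit_factor_top[OF assms(6)[unfolded Mn] assms(8) \<open>1 < p\<close> \<open>0 < m n\<close>]) simp
  finally show ?thesis by (simp only: if_distrib[of "\<lambda>x. x * _"] mult_zero_left)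
qed

end
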